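(* Let $X$ be an $\mathbb{N}$-valued random variable with $T=\mathbb{E}X>0$ and density $f$ with respect to $\pi_T$, where $f:\mathbb{N}\to(0,\infty)$ is log-concave. Let $(X_i)_{i\ge1}$ be i.i.d. copies of $X$. Then for every $n\ge2$ $$H\Big(\sum_{i=1}^nT_{1/n}(X_i)\,\Big|\,\pi_T\Big)\le\frac{1}{n(n-1)}T^2+\frac{1}{n(n-1)^2}\frac{T^3}{4},$$ and for every constant $c>1$ one has, for all large enough $n$, $$H\Big(\sum_{i=1}^nT_{1/n}(X_i)\,\Big|\,\pi_T\Big)\le c\,\frac{T^2}{n^2}.$$
   Context: $\mathbb{N}=\{0,1,2,\dots\}$. For $T>0$, $\pi_T(k)=e^{-T}T^k/k!$ is the Poisson measure on $\mathbb{N}$. "$X$ has density $f$ with respect to $\pi_T$" means $\mathbb{P}(X=k)=f(k)\pi_T(k)$ for all $k$. A function $f:\mathbb{N}\to(0,\infty)$ is log-concave if $f(k)^2\ge f(k+1)f(k-1)$ for all $k\ge1$. For $a\in[0,1]$ the $a$-thinning of $X$ is $T_a(X):=\sum_{i=1}^X B_i$, where $(B_i)_{i\ge1}$ are i.i.d. Bernoulli random variables with $\mathbb{P}(B_i=1)=a$, independent of $X$; the thinnings $T_{1/n}(X_1),\dots,T_{1/n}(X_n)$ are taken independent. If $Y$ has density $g$ with respect to $\pi_T$, the relative entropy is $H(Y|\pi_T)=\sum_k g(k)\log(g(k))\,\pi_T(k)$, with $0\log0=0$. *)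

theory Defs
  imports "HOL-Probability.Probability"
begin

definition log_concave :: "(nat \<Rightarrow> real) \<Rightarrow> bool" where
  "log_concave f \<longleftrightarrow> (\<forall>k\<ge>1. (f k)\<^sup>2 \<ge> f (k + 1) * f (k - 1))"

definition has_poisson_density :: "'a measure \<Rightarrow> real \<Rightarrow> ('a \<Rightarrow> nat) \<Rightarrow> (nat \<Rightarrow> real) \<Rightarrow> bool" where
  "has_poisson_density M T Y g \<longleftrightarrow>
     (\<forall>k. measure M {\<omega> \<in> space M. Y \<omega> = k} = g k * pmf (poisson_pmf T) k)"

definition poisson_density :: "'a measure \<Rightarrow> real \<Rightarrow> ('a \<Rightarrow> nat) \<Rightarrow> nat \<Rightarrow> real" where
  "poisson_density M T Y k =
     measure M {\<omega> \<in> space M. Y \<omega> = k} / pmf (poisson_pmf T) k"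

lemma has_poisson_density_iff:
  assumes "T > 0"
  shows "has_poisson_density M T Y g \<longleftrightarrow> g = poisson_density M T Y"
proof -
  have "pmf (poisson_pmf T) k \<noteq> 0" for k
    using assms by simp
  then show ?thesis
    by (auto simp: has_poisson_density_def poisson_density_def fun_eq_iff field_simps)
qed

text \<open>
  The sum of g log g with respect to the Poisson measure in the extended reals:
  positive part minus negative part, where \<^const>\<open>ennreal\<close> truncates negative numbers at 0.
  The negative part is at most exp(-1) for positive T, so the difference is never of the form infinity minus
  infinity, and the value is infinity exactly if the series diverges.
  The convention 0 log 0 = 0 holds because of the factor g k.
\<close>
definition relative_entropy :: "'a measure \<Rightarrow> real \<Rightarrow> ('a \<Rightarrow> nat) \<Rightarrow> ereal" where
  "relative_entropy M T Y =
     (let g = poisson_density M T Y;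
          h = (\<lambda>k. g k * ln (g k) * pmf (poisson_pmf T) k)
      in enn2ereal (\<Sum>k. ennreal (h k)) - enn2ereal (\<Sum>k. ennreal (- h k)))"

definition iid_copies :: "'a measure \<Rightarrow> ('a \<Rightarrow> nat) \<Rightarrow> (nat \<Rightarrow> 'a \<Rightarrow> nat) \<Rightarrow> bool" where
  "iid_copies M X Xs \<longleftrightarrow>
     prob_space.indep_vars M (\<lambda>_. count_space UNIV) Xs {1..} \<and>
     (\<forall>i\<ge>1. distr M (count_space UNIV) (Xs i) = distr M (count_space UNIV) X)"

text \<open>
  The sequence (B j) for j \<open>\<ge>\<close> 1 is i.i.d. Bernoulli(a) and independent of X. Independence is
  expressed jointly: X is put in the slot 0, which the Bernoulli sequence does not use.
\<close>
definition thinning_seq :: "'a measure \<Rightarrow> real \<Rightarrow> ('a \<Rightarrow> nat) \<Rightarrow> (nat \<Rightarrow> 'a \<Rightarrow> nat) \<Rightarrow> bool" where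
  "thinning_seq M a X B \<longleftrightarrow>
     prob_space.indep_vars M (\<lambda>_. count_space UNIV) (B(0 := X)) UNIV \<and>
     (\<forall>j\<ge>1. measure M {\<omega> \<in> space M. B j \<omega> = 1} = a \<and>
            measure M {\<omega> \<in> space M. B j \<omega> = 0} = 1 - a)"

definition thinning :: "(nat \<Rightarrow> 'a \<Rightarrow> nat) \<Rightarrow> ('a \<Rightarrow> nat) \<Rightarrow> 'a \<Rightarrow> nat" where
  "thinning B X \<omega> = (\<Sum>j=1..X \<omega>. B j \<omega>)"

end

theory Submission
  imports Defs "HOL-Real_Asymp.Real_Asymp"
begin

text \<open>
  For a positive law \<open>P\<close> on the naturals put \<open>R k = (k + 1) P(k + 1) / P(k)\<close>; under \<open>P\<close> this score has the
  same mean as \<open>P\<close>. If that mean is \<open>T\<close>, the Poisson logarithmic Sobolev inequality of Bobkov and Ledoux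
  bounds the entropy of \<open>P\<close> relative to the Poisson law by \<open>Var R / T\<close>. It follows from its binomial
  analogue, which tensorises from two points, by the Poisson limit.
  The variance of the score is subadditive under convolution, since the score of a sum of independent
  variables is the conditional expectation of the sum of their scores.

  With \<open>Z\<close> the \<open>a\<close>-thinning of \<open>X\<close>, the score of \<open>Z\<close> at \<open>k\<close> is \<open>a / (1 - a)\<close> times
  the conditional mean of \<open>X - Z\<close> given \<open>Z = k\<close>. Log-concavity makes the law of \<open>X - Z\<close> given \<open>Z = k\<close>
  smaller, in likelihood ratio, than its law given \<open>Z = 0\<close>, and so the score is at most
  \<open>a T (1 + a T / (1 - a))\<close>. A variable in \<open>[0, b]\<close> with mean \<open>m\<close> has variance at most
  \<open>m (b - m)\<close>, so the score of \<open>Z\<close> has variance at most \<open>(a T)^3 / (1 - a)\<close>. For \<open>a = 1 / n\<close>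
  the sum of \<open>n\<close> thinnings therefore has entropy at most \<open>T^2 / (n (n - 1))\<close>.
\<close>

section \<open>The Poisson logarithmic Sobolev inequality\<close>

definition binom_op :: "real \<Rightarrow> nat \<Rightarrow> (nat \<Rightarrow> real) \<Rightarrow> real" where
  "binom_op p N \<phi> = (\<Sum>k\<le>N. real (N choose k) * p ^ k * (1 - p) ^ (N - k) * \<phi> k)"

text \<open>Pascal's rule: conditioning on the first N trials replaces \<open>\<phi>\<close> by its
  average over the last one. Inductions on the number of trials run on this recursion.\<close>

lemma binom_op_Suc:
  "binom_op p (Suc N) \<phi> = binom_op p N (\<lambda>k. (1 - p) * \<phi> k + p * \<phi> (Suc k))"
proof -
  have "binom_op p (Suc N) \<phi> = (1 - p) ^ Suc N * \<phi> 0
      + (\<Sum>k\<le>N. real (N choose Suc k) * p ^ Suc k * (1 - p) ^ (N - k) * \<phi> (Suc k))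
      + (\<Sum>k\<le>N. real (N choose k) * p ^ Suc k * (1 - p) ^ (N - k) * \<phi> (Suc k))"
    unfolding binom_op_def
    by (subst sum.atMost_Suc_shift) (simp add: algebra_simps sum.distrib)
  also have "(1 - p) ^ Suc N * \<phi> 0
      + (\<Sum>k\<le>N. real (N choose Suc k) * p ^ Suc k * (1 - p) ^ (N - k) * \<phi> (Suc k))
      = (\<Sum>k\<le>Suc N. real (N choose k) * p ^ k * (1 - p) ^ (Suc N - k) * \<phi> k)"
    by (subst sum.atMost_Suc_shift) simp
  also have "\<dots> = (\<Sum>k\<le>N. real (N choose k) * p ^ k * (1 - p) ^ (N - k) * ((1 - p) * \<phi> k))"
    by (simp add: Suc_diff_le mult_ac)
  finally show ?thesis
    unfolding binom_op_def distrib_left sum.distrib by (simp add: mult_ac)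
qed

lemma binom_op_mono:
  assumes "0 \<le> p" "p \<le> 1" "\<And>k. \<phi> k \<le> \<psi> k"
  shows "binom_op p N \<phi> \<le> binom_op p N \<psi>"
  unfolding binom_op_def using assms by (intro sum_mono mult_left_mono) auto

lemma binom_op_add: "binom_op p N (\<lambda>k. \<phi> k + \<psi> k) = binom_op p N \<phi> + binom_op p N \<psi>"
  by (simp add: binom_op_def algebra_simps sum.distrib)

lemma binom_op_diff: "binom_op p N (\<lambda>k. \<phi> k - \<psi> k) = binom_op p N \<phi> - binom_op p N \<psi>"
  by (simp add: binom_op_def algebra_simps sum_subtractf)

lemma binom_op_cmult: "binom_op p N (\<lambda>k. c * \<phi> k) = c * binom_op p N \<phi>"
  by (simp add: binom_op_def algebra_simps sum_distrib_left)

text \<open>The inequality ln y <= y - 1 bounds \<open>w * ln w\<close> below and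
  \<open>v * ln v\<close> above in terms of \<open>ln u\<close>; the terms in \<open>ln u\<close>
  cancel because \<open>w\<close> is the mean of \<open>u\<close> and \<open>v\<close>.\<close>

lemma two_point_entropy_le:
  fixes u v p :: real
  assumes "u > 0" "v > 0" "0 \<le> p" "p \<le> 1"
  defines "w \<equiv> (1 - p) * u + p * v"
  shows "(1 - p) * (u * ln u) + p * (v * ln v) - w * ln w \<le> p * ((v - u)\<^sup>2 / u)"
proof -
  have w: "w > 0"
    using assms by (cases "p = 0") (auto simp: w_def intro!: add_nonneg_pos)
  have "ln (u / w) \<le> u / w - 1" using assms w by (intro ln_le_minus_one) auto
  then have "w * ln (u / w) \<le> w * (u / w - 1)" using w by (intro mult_left_mono) auto
  then have 1: "w * ln u + w - u \<le> w * ln w"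
    using w assms(1) by (simp add: ln_div right_diff_distrib)
  have "ln (v / u) \<le> v / u - 1" using assms by (intro ln_le_minus_one) auto
  then have "p * (v * ln (v / u)) \<le> p * (v * (v / u - 1))"
    using assms by (intro mult_left_mono) auto
  then have 2: "p * (v * ln v) \<le> p * v * ln u + p * v * (v / u - 1)"
    using assms by (simp add: ln_div algebra_simps)
  have "(1 - p) * (u * ln u) + p * (v * ln v) - w * ln w
      \<le> (1 - p) * (u * ln u) + (p * v * ln u + p * v * (v / u - 1)) - (w * ln u + w - u)"
    using 1 2 by linarith
  also have "\<dots> = p * v * (v / u - 1) - p * (v - u)"
    by (simp add: w_def algebra_simps)
  also have "\<dots> = p * ((v - u)\<^sup>2 / u)"
    using assms by (simp add: field_simps power2_eq_square)
  finally show ?thesis .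
qed

text \<open>Joint convexity of a^2 / x for x > 0: after clearing denominators the gap is p (1 - p)
  (a y - b x)^2.\<close>

lemma square_over_linear_convex:
  fixes a b x y p :: real
  assumes "x > 0" "y > 0" "0 \<le> p" "p \<le> 1"
  shows "((1 - p) * a + p * b)\<^sup>2 / ((1 - p) * x + p * y) \<le> (1 - p) * (a\<^sup>2 / x) + p * (b\<^sup>2 / y)"
proof -
  have w: "(1 - p) * x + p * y > 0"
    using assms by (cases "p = 0") (auto intro!: add_nonneg_pos)
  have "((1 - p) * a\<^sup>2 * y + p * b\<^sup>2 * x) * ((1 - p) * x + p * y) - ((1 - p) * a + p * b)\<^sup>2 * (x * y)
     = p * (1 - p) * (a * y - b * x)\<^sup>2"
    by (simp add: power2_eq_square algebra_simps)
  moreover have "\<dots> \<ge> 0" using assms by simp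
  ultimately have "((1 - p) * a + p * b)\<^sup>2 * (x * y)
      \<le> ((1 - p) * a\<^sup>2 * y + p * b\<^sup>2 * x) * ((1 - p) * x + p * y)" by linarith
  then have "((1 - p) * a + p * b)\<^sup>2 / ((1 - p) * x + p * y) \<le> ((1 - p) * a\<^sup>2 * y + p * b\<^sup>2 * x) / (x * y)"
    using assms w by (subst frac_le_eq) (auto simp: divide_le_0_iff mult_ac)
  also have "\<dots> = (1 - p) * (a\<^sup>2 / x) + p * (b\<^sup>2 / y)"
    using assms by (simp add: field_simps)
  finally show ?thesis .
qed

text \<open>Tensorisation: the entropy splits into the mean entropy of the last trial given the
  others, controlled by the two-point inequality, and the entropy of the averaged function
  \<open>h\<close>, controlled by induction. Convexity of a^2 / x brings the energy of
  \<open>h\<close> back to that of \<open>g\<close>.\<close>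

lemma binom_log_sobolev:
  assumes "0 \<le> p" "p < 1" "\<And>k. g k > 0"
  shows "binom_op p N (\<lambda>k. g k * ln (g k)) - binom_op p N g * ln (binom_op p N g)
     \<le> real N * p / (1 - p) * binom_op p N (\<lambda>k. (g (Suc k) - g k)\<^sup>2 / g k)"
  using assms(3)
proof (induction N arbitrary: g)
  case 0
  then show ?case by (simp add: binom_op_def)
next
  case (Suc N)
  define h where "h = (\<lambda>k. (1 - p) * g k + p * g (Suc k))"
  define G where "G = (\<lambda>k. (g (Suc k) - g k)\<^sup>2 / g k)"
  have h: "h k > 0" for k
    using assms Suc.prems[of k] Suc.prems[of "Suc k"] by (auto simp: h_def intro!: add_pos_nonneg)
  have G: "G k \<ge> 0" for k
    using Suc.prems[of k] by (simp add: G_def)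
  have "binom_op p (Suc N) (\<lambda>k. g k * ln (g k)) - binom_op p N (\<lambda>k. h k * ln (h k))
      \<le> binom_op p N (\<lambda>k. p * G k)"
    unfolding binom_op_Suc binom_op_diff[symmetric] h_def G_def
    using two_point_entropy_le Suc.prems assms by (intro binom_op_mono) (auto simp: less_imp_le)
  \<comment> \<open>The two-point bound yields \<open>G k\<close> alone. Completing it to
    \<open>(1 - p) * G k + p * G (Suc k)\<close>, the average over the last trial, costs the factor
    1 / (1 - p), which tends to 1 in the Poisson limit.\<close>
  also have "\<dots> = p / (1 - p) * binom_op p N (\<lambda>k. (1 - p) * G k)"
    using assms by (simp add: binom_op_cmult)
  also have "\<dots> \<le> p / (1 - p) * binom_op p (Suc N) G"
    unfolding binom_op_Suc using assms G by (intro mult_left_mono binom_op_mono) auto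
  finally have 1: "binom_op p (Suc N) (\<lambda>k. g k * ln (g k)) - binom_op p N (\<lambda>k. h k * ln (h k))
      \<le> p / (1 - p) * binom_op p (Suc N) G" .
  have "binom_op p N (\<lambda>k. h k * ln (h k)) - binom_op p N h * ln (binom_op p N h)
     \<le> real N * p / (1 - p) * binom_op p N (\<lambda>k. (h (Suc k) - h k)\<^sup>2 / h k)"
    by (rule Suc.IH) (rule h)
  also have "\<dots> \<le> real N * p / (1 - p) * binom_op p (Suc N) G"
    unfolding binom_op_Suc
  proof (intro mult_left_mono binom_op_mono)
    fix k
    have "(h (Suc k) - h k)\<^sup>2 / h k
       = ((1 - p) * (g (Suc k) - g k) + p * (g (Suc (Suc k)) - g (Suc k)))\<^sup>2
          / ((1 - p) * g k + p * g (Suc k))"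
      by (simp add: h_def algebra_simps)
    also have "\<dots> \<le> (1 - p) * G k + p * G (Suc k)"
      unfolding G_def using assms Suc.prems by (intro square_over_linear_convex) auto
    finally show "(h (Suc k) - h k)\<^sup>2 / h k \<le> (1 - p) * G k + p * G (Suc k)" .
  qed (use assms in auto)
  finally have 2: "binom_op p N (\<lambda>k. h k * ln (h k)) - binom_op p N h * ln (binom_op p N h)
     \<le> real N * p / (1 - p) * binom_op p (Suc N) G" .
  have "binom_op p (Suc N) g = binom_op p N h"
    by (simp add: binom_op_Suc h_def)
  with 1 2 show ?case
    unfolding G_def[symmetric] by (simp add: algebra_simps add_divide_distrib)
qed

section \<open>Passage from binomial to Poisson averages\<close>

lemma binomial_weight_tendsto_poisson:
  fixes T :: real
  shows "(\<lambda>N. real (N choose k) * (T / real N) ^ k * (1 - T / real N) ^ (N - k))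
    \<longlonglongrightarrow> T ^ k / fact k * exp (- T)"
proof (induction k)
  case 0
  show ?case using tendsto_exp_limit_sequentially[of "-T"] by simp
next
  case (Suc k)
  let ?c = "\<lambda>k N. real (N choose k) * (T / real N) ^ k * (1 - T / real N) ^ (N - k)"
  \<comment> \<open>The ratio of the weights at k + 1 and k is this fraction times T / (k +
    1).\<close>
  have "(\<lambda>N. (real N - real k) / (real N - T)) \<longlonglongrightarrow> 1"
    by real_asymp
  from tendsto_mult[OF tendsto_mult[OF Suc tendsto_const[of "T / (real k + 1)"]] this]
  have "(\<lambda>N. ?c k N * (T / (real k + 1)) * ((real N - real k) / (real N - T)))
     \<longlonglongrightarrow> T ^ Suc k / fact (Suc k) * exp (- T)"
    by (simp add: field_simps)
  moreover have "\<forall>\<^sub>F N in sequentially.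
     ?c k N * (T / (real k + 1)) * ((real N - real k) / (real N - T)) = ?c (Suc k) N"
    using eventually_gt_at_top[of k] eventually_gt_at_top[of "nat \<lceil>T\<rceil>"]
  proof eventually_elim
    case (elim N)
    have N: "real N > T" "N > 0" using elim by linarith+
    have "real (Suc k) * real (N choose Suc k) = (real N - real k) * real (N choose k)"
      using elim
      by (metis (no_types, lifting) less_imp_le of_nat_diff of_nat_mult binomial_absorption binomial_absorb_comp)
    then have c: "real (N choose Suc k) = (real N - real k) * real (N choose k) / (real k + 1)"
      by (simp add: field_simps)
    have d: "N - k = Suc (N - Suc k)" using elim by simp
    have e: "1 - T / real N = (real N - T) / real N" using N by (simp add: field_simps)
    have "x * Z * (D / real N * Q) * (T / (real k + 1)) * (m / D)
        = m * x / (real k + 1) * (T / real N * Z) * Q" if "D \<noteq> 0" for x Z Q m D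
      using N that by (simp add: field_simps)
    moreover have "real N - T \<noteq> 0" using N by simp
    ultimately show ?case
      unfolding c d power_Suc e by blast
  qed
  ultimately show ?case by (rule Lim_transform_eventually)
qed

lemma summable_poisson_geometric:
  fixes T :: real
  assumes "T > 0" "\<And>k. \<bar>\<phi> k\<bar> \<le> C * R ^ k"
  shows "summable (\<lambda>k. \<bar>pmf (poisson_pmf T) k * \<phi> k\<bar>)"
proof (rule summable_comparison_test)
  show "summable (\<lambda>k. C * (exp (- T) * ((T * R) ^ k / fact k)))"
    using summable_exp[of "T * R"] by (intro summable_mult) (simp add: field_simps)
  have "norm \<bar>pmf (poisson_pmf T) k * \<phi> k\<bar> \<le> C * (exp (- T) * ((T * R) ^ k / fact k))" for k
    using mult_left_mono[OF assms(2)[of k], of "pmf (poisson_pmf T) k"] assms(1)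
    by (simp add: abs_mult power_mult_distrib field_simps)
  then show "\<exists>N. \<forall>n\<ge>N. norm \<bar>pmf (poisson_pmf T) n * \<phi> n\<bar> \<le> C * (exp (- T) * ((T * R) ^ n / fact n))"
    by blast
qed

text \<open>Tannery's theorem with dominating series C (T R)^k / k!: once N > T, the binomial
  coefficient divided by N^k is at most 1 / k!, and the power of 1 - T / N is at most 1.\<close>

lemma binom_op_tendsto_poisson:
  fixes T :: real
  assumes "T > 0" "\<And>k. \<bar>\<phi> k\<bar> \<le> C * R ^ k"
  shows "(\<lambda>N. binom_op (T / real N) N \<phi>) \<longlonglongrightarrow> (\<Sum>k. pmf (poisson_pmf T) k * \<phi> k)"
proof -
  define a where "a = (\<lambda>k N. real (N choose k) * (T / real N) ^ k * (1 - T / real N) ^ (N - k) * \<phi> k)"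
  have lim: "(\<lambda>N. a k N) \<longlonglongrightarrow> pmf (poisson_pmf T) k * \<phi> k" for k
    unfolding a_def using assms
    using binomial_weight_tendsto_poisson by (intro tendsto_mult tendsto_const) simp
  have bnd: "norm (a k N) \<le> C * (T * R) ^ k / fact k" if N: "N \<ge> nat \<lceil>T\<rceil> + 1" for k N
  proof -
    have N': "real N \<ge> T" "N > 0" using N by linarith+
    have "real (N choose k) * (T / real N) ^ k \<le> T ^ k / fact k"
    proof -
      have "real ((N choose k) * fact k) \<le> real (N ^ k)"
        using binomial_fact_pow[of N k] by linarith
      then have "real (N choose k) * fact k * T ^ k \<le> real N ^ k * T ^ k"
        using assms by (intro mult_right_mono) auto
      then show ?thesis using N' by (simp add: field_simps power_divide)
    qed
    moreover have "(1 - T / real N) ^ (N - k) \<le> 1"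
      using N' assms by (intro power_le_one) (auto simp: field_simps)
    ultimately have "real (N choose k) * (T / real N) ^ k * (1 - T / real N) ^ (N - k) \<le> T ^ k / fact k * 1"
      using N' assms by (intro mult_mono) auto
    then have "norm (a k N) \<le> T ^ k / fact k * (C * R ^ k)"
      using assms(1) assms(2)[of k] N' unfolding a_def norm_mult
      by (intro mult_mono) (auto simp: abs_mult)
    then show ?thesis by (simp add: power_mult_distrib field_simps)
  qed
  have "summable (\<lambda>k. C * (T * R) ^ k / fact k)"
    using summable_mult[OF summable_exp[of "T * R"], of C] by (simp add: field_simps)
  moreover have "eventually (\<lambda>(k, N). norm (a k N) \<le> C * (T * R) ^ k / fact k) (at_top \<times>\<^sub>F sequentially)"
    unfolding eventually_prod_filter
    by (rule exI[of _ "\<lambda>_. True"], rule exI[of _ "\<lambda>N. N \<ge> nat \<lceil>T\<rceil> + 1"])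
       (use bnd in \<open>auto simp: eventually_at_top_linorder\<close>)
  ultimately have "(\<lambda>N. \<Sum>k. a k N) \<longlonglongrightarrow> (\<Sum>k. pmf (poisson_pmf T) k * \<phi> k)"
    using tannerys_theorem[of a _ sequentially] lim by auto
  moreover have "(\<Sum>k. a k N) = binom_op (T / real N) N \<phi>" for N
    unfolding binom_op_def a_def
    by (intro suminf_finite) (auto simp: not_le)
  ultimately show ?thesis by simp
qed

text \<open>The binomial inequality at p = T / N, as N tends to infinity: the constant N p / (1 - p)
  tends to T. The geometric bounds on \<open>g\<close> and on the energy justify the limit, and mean
  1 makes the term m ln m vanish.\<close>

lemma poisson_log_sobolev:
  fixes T :: real
  assumes T: "T > 0"
    and pos: "\<And>k. g k > 0"
    and g_le: "\<And>k. g k \<le> C * R ^ k"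
    and D_le: "\<And>k. (g (Suc k) - g k)\<^sup>2 / g k \<le> D * S ^ k"
    and mean: "(\<Sum>k. pmf (poisson_pmf T) k * g k) = 1"
  shows "summable (\<lambda>k. \<bar>pmf (poisson_pmf T) k * (g k * ln (g k))\<bar>)"
    and "(\<Sum>k. pmf (poisson_pmf T) k * (g k * ln (g k)))
       \<le> T * (\<Sum>k. pmf (poisson_pmf T) k * ((g (Suc k) - g k)\<^sup>2 / g k))"
proof -
  \<comment> \<open>Enlarging both constants gives a majorant that is also at least 1. Its square
    then dominates the absolute value of \<open>g k * ln (g k)\<close>, since -1 <= y ln y <=
    y^2.\<close>
  have R: "(\<bar>C\<bar> + 1) * (\<bar>R\<bar> + 1) ^ k \<ge> \<bar>g k\<bar>" "(\<bar>C\<bar> + 1) * (\<bar>R\<bar> + 1) ^ k \<ge> 1" for k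
  proof -
    have "g k \<le> \<bar>C\<bar> * \<bar>R\<bar> ^ k"
      using g_le[of k] by (metis abs_ge_self abs_mult order_trans power_abs)
    also have "\<dots> \<le> (\<bar>C\<bar> + 1) * (\<bar>R\<bar> + 1) ^ k"
      by (intro mult_mono power_mono) auto
    finally show "(\<bar>C\<bar> + 1) * (\<bar>R\<bar> + 1) ^ k \<ge> \<bar>g k\<bar>" using pos[of k] by simp
    have "1 * 1 \<le> (\<bar>C\<bar> + 1) * (\<bar>R\<bar> + 1) ^ k"
      by (intro mult_mono one_le_power) auto
    then show "(\<bar>C\<bar> + 1) * (\<bar>R\<bar> + 1) ^ k \<ge> 1" by simp
  qed
  have e: "\<bar>g k * ln (g k)\<bar> \<le> (\<bar>C\<bar> + 1)\<^sup>2 * ((\<bar>R\<bar> + 1)\<^sup>2) ^ k" for k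
  proof -
    let ?y = "(\<bar>C\<bar> + 1) * (\<bar>R\<bar> + 1) ^ k"
    have "ln (g k) \<le> g k - 1" "ln (1 / g k) \<le> 1 / g k - 1"
      using pos[of k] by (intro ln_le_minus_one; simp)+
    then have "g k * ln (g k) \<le> g k * (g k - 1)" "g k * ln (1 / g k) \<le> g k * (1 / g k - 1)"
      using pos[of k] by (intro mult_left_mono; simp)+
    then have "g k * ln (g k) \<le> g k * g k" "- (g k * ln (g k)) \<le> 1"
        using pos[of k] by (simp_all only: ln_div ln_one right_diff_distrib) (simp_all add: ln_div)
    moreover have "g k * g k \<le> ?y * ?y" "1 * 1 \<le> ?y * ?y"
      using R[of k] pos[of k] by (intro mult_mono; simp)+
    ultimately have "\<bar>g k * ln (g k)\<bar> \<le> ?y * ?y" by linarith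
    then show ?thesis by (simp add: power2_eq_square power_mult_distrib mult_ac)
  qed
  show "summable (\<lambda>k. \<bar>pmf (poisson_pmf T) k * (g k * ln (g k))\<bar>)"
    using T by (intro summable_poisson_geometric[OF _ e]) auto
  have d: "\<bar>(g (Suc k) - g k)\<^sup>2 / g k\<bar> \<le> D * S ^ k" for k
    using D_le[of k] pos[of k] by simp
  let ?I = "\<lambda>\<phi>. \<Sum>k. pmf (poisson_pmf T) k * \<phi> k"
  have lg: "(\<lambda>N. binom_op (T / real N) N g) \<longlonglongrightarrow> 1"
    using binom_op_tendsto_poisson[OF T R(1)] mean by simp
  have "(\<lambda>N. binom_op (T / real N) N (\<lambda>k. g k * ln (g k))
        - binom_op (T / real N) N g * ln (binom_op (T / real N) N g))
      \<longlonglongrightarrow> ?I (\<lambda>k. g k * ln (g k)) - 1 * ln 1"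
    by (intro tendsto_intros binom_op_tendsto_poisson[OF T e] lg) auto
  moreover have "(\<lambda>N. real N * (T / real N) / (1 - T / real N)
        * binom_op (T / real N) N (\<lambda>k. (g (Suc k) - g k)\<^sup>2 / g k))
      \<longlonglongrightarrow> T * ?I (\<lambda>k. (g (Suc k) - g k)\<^sup>2 / g k)"
  proof (intro tendsto_mult binom_op_tendsto_poisson[OF T d])
    show "(\<lambda>N. real N * (T / real N) / (1 - T / real N)) \<longlonglongrightarrow> T"
      using T by real_asymp
  qed
  moreover have "\<forall>\<^sub>F N in sequentially.
       binom_op (T / real N) N (\<lambda>k. g k * ln (g k))
        - binom_op (T / real N) N g * ln (binom_op (T / real N) N g)
       \<le> real N * (T / real N) / (1 - T / real N)
        * binom_op (T / real N) N (\<lambda>k. (g (Suc k) - g k)\<^sup>2 / g k)"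
    using eventually_gt_at_top[of "nat \<lceil>T\<rceil>"]
  proof eventually_elim
    case (elim N)
    then have "real N > T" "N > 0" by linarith+
    then show ?case using T pos by (intro binom_log_sobolev) auto
  qed
  ultimately have "?I (\<lambda>k. g k * ln (g k)) - 1 * ln 1 \<le> T * ?I (\<lambda>k. (g (Suc k) - g k)\<^sup>2 / g k)"
    by (intro tendsto_le[OF trivial_limit_sequentially]) auto
  then show "?I (\<lambda>k. g k * ln (g k)) \<le> T * ?I (\<lambda>k. (g (Suc k) - g k)\<^sup>2 / g k)" by simp
qed

section \<open>Scores and convolution\<close>

definition conv :: "(nat \<Rightarrow> real) \<Rightarrow> (nat \<Rightarrow> real) \<Rightarrow> nat \<Rightarrow> real" where
  "conv P Q k = (\<Sum>i\<le>k. P i * Q (k - i))"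

text \<open>If \<open>P\<close> has density \<open>g\<close> with respect to the Poisson law of parameter \<open>T\<close>, then
  \<open>score P k = T * g (k + 1) / g k\<close>.\<close>
definition score :: "(nat \<Rightarrow> real) \<Rightarrow> nat \<Rightarrow> real" where
  "score P k = real (Suc k) * P (Suc k) / P k"

text \<open>\<open>m\<close> is the mean of \<open>P\<close>, hence also the mean of the score under \<open>P\<close>, and \<open>V\<close> bounds the
  variance of the score.\<close>
definition score_bounds :: "(nat \<Rightarrow> real) \<Rightarrow> real \<Rightarrow> real \<Rightarrow> real \<Rightarrow> bool" where
  "score_bounds P m V B \<longleftrightarrow>
     (\<forall>k. P k > 0) \<and> P sums 1 \<and> (\<lambda>k. score P k * P k) sums m \<and> (\<forall>k. score P k \<le> B) \<and>
     summable (\<lambda>k. (score P k)\<^sup>2 * P k) \<and> (\<Sum>k. (score P k)\<^sup>2 * P k) \<le> m\<^sup>2 + V"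

lemma conv_pos:
  assumes "\<And>k. P k > 0" "\<And>k. Q k > 0"
  shows "conv P Q k > 0"
  unfolding conv_def using assms by (intro sum_pos) auto

lemma conv_sums:
  assumes "P sums a" "Q sums b" "\<And>k. P k \<ge> 0" "\<And>k. Q k \<ge> 0"
  shows "conv P Q sums (a * b)"
  using Cauchy_product_sums[of P Q] assms by (simp add: conv_def[abs_def] sums_iff)

lemma score_nonneg: "(\<And>k. P k > 0) \<Longrightarrow> score P k \<ge> 0"
  by (auto simp: score_def less_imp_le)

lemma score_mult:
  assumes "\<And>k. P k > 0"
  shows "score P k * P k = real (Suc k) * P (Suc k)"
  using assms[of k] by (simp add: score_def)

text \<open>In the convolution sum at k + 1 the factor k + 1 is split as i + (k + 1 - i). The first
  part vanishes at i = 0 and is shifted by one, the second vanishes at i = k + 1, so both run over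
  the decompositions of k.\<close>

lemma score_conv:
  assumes P: "\<And>k. P k > 0" and Q: "\<And>k. Q k > 0"
  shows "score (conv P Q) k * conv P Q k = (\<Sum>i\<le>k. P i * Q (k - i) * (score P i + score Q (k - i)))"
proof -
  have "score (conv P Q) k * conv P Q k = real (Suc k) * conv P Q (Suc k)"
    using score_mult conv_pos P Q by blast
  also have "\<dots> = (\<Sum>i\<le>Suc k. real (Suc k) * (P i * Q (Suc k - i)))"
    by (simp only: conv_def sum_distrib_left)
  also have "\<dots> = (\<Sum>i\<le>Suc k. real i * P i * Q (Suc k - i) + P i * (real (Suc k - i) * Q (Suc k - i)))"
    by (intro sum.cong refl) (auto simp: of_nat_diff algebra_simps)
  also have "\<dots> = (\<Sum>i\<le>Suc k. real i * P i * Q (Suc k - i))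
      + (\<Sum>i\<le>Suc k. P i * (real (Suc k - i) * Q (Suc k - i)))"
    by (rule sum.distrib)
  also have "(\<Sum>i\<le>Suc k. real i * P i * Q (Suc k - i)) = (\<Sum>i\<le>k. score P i * P i * Q (k - i))"
    by (subst sum.atMost_Suc_shift) (simp add: score_mult[of P, OF P] del: of_nat_Suc)
  also have "(\<Sum>i\<le>Suc k. P i * (real (Suc k - i) * Q (Suc k - i)))
      = (\<Sum>i\<le>k. P i * (real (Suc k - i) * Q (Suc k - i)))"
    by simp
  also have "\<dots> = (\<Sum>i\<le>k. P i * (score Q (k - i) * Q (k - i)))"
    by (intro sum.cong refl) (simp only: score_mult[of Q, OF Q] Suc_diff_le atMost_iff)
  finally show ?thesis
    by (simp add: sum.distrib[symmetric] algebra_simps)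
qed

lemma weighted_Cauchy_Schwarz:
  fixes w x :: "'a \<Rightarrow> real"
  assumes "\<And>i. i \<in> I \<Longrightarrow> w i \<ge> 0"
  shows "(\<Sum>i\<in>I. w i * x i)\<^sup>2 \<le> (\<Sum>i\<in>I. w i) * (\<Sum>i\<in>I. w i * (x i)\<^sup>2)"
proof -
  have "(\<Sum>i\<in>I. sqrt (w i) * (sqrt (w i) * x i))\<^sup>2
      \<le> (\<Sum>i\<in>I. (sqrt (w i))\<^sup>2) * (\<Sum>i\<in>I. (sqrt (w i) * x i)\<^sup>2)"
    by (rule Cauchy_Schwarz_ineq_sum)
  moreover have "sqrt (w i) * (sqrt (w i) * x i) = w i * x i" "(sqrt (w i) * x i)\<^sup>2 = w i * (x i)\<^sup>2"
    "(sqrt (w i))\<^sup>2 = w i" if "i \<in> I" for i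
    using assms[OF that] by (simp_all add: power_mult_distrib mult.assoc[symmetric])
  ultimately show ?thesis by (simp cong: sum.cong)
qed

text \<open>By \<open>score_conv\<close>, the score of the convolution is the conditional expectation of the sum of the two
  scores given the sum of the two variables.\<close>
lemma score_bounds_conv:
  assumes P: "score_bounds P m V B" and Q: "score_bounds Q m' V' B'"
  shows "score_bounds (conv P Q) (m + m') (V + V') (B + B')"
proof -
  note d = score_bounds_def
  have Pp: "\<And>k. P k > 0" and Qp: "\<And>k. Q k > 0" using P Q by (auto simp: d)
  note cp = conv_pos[of P Q, OF Pp Qp]
  have nn: "score P k \<ge> 0" "score Q k \<ge> 0" "P k \<ge> 0" "Q k \<ge> 0" for k
    using Pp Qp by (auto intro: score_nonneg less_imp_le)
  let ?w = "\<lambda>k i. P i * Q (k - i)"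
  let ?J = "\<lambda>P. \<Sum>k. (score P k)\<^sup>2 * P k"
  have one: "conv P Q sums 1"
    using conv_sums[of P 1 Q 1] P Q nn by (auto simp: d)
  have mean: "(\<lambda>k. score (conv P Q) k * conv P Q k) sums (m + m')"
  proof -
    have "(\<lambda>k. conv (\<lambda>k. score P k * P k) Q k + conv P (\<lambda>k. score Q k * Q k) k) sums (m * 1 + 1 * m')"
      using P Q nn by (intro sums_add conv_sums) (auto simp: d)
    also have "(\<lambda>k. conv (\<lambda>k. score P k * P k) Q k + conv P (\<lambda>k. score Q k * Q k) k)
       = (\<lambda>k. score (conv P Q) k * conv P Q k)"
      unfolding score_conv[OF Pp Qp] by (simp add: conv_def fun_eq_iff algebra_simps sum.distrib)
    finally show ?thesis by simp
  qed
  have bound: "score (conv P Q) k \<le> B + B'" for k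
  proof -
    have "score (conv P Q) k * conv P Q k \<le> (\<Sum>i\<le>k. ?w k i * (B + B'))"
      unfolding score_conv[OF Pp Qp] using P Q nn
      by (intro sum_mono mult_left_mono add_mono) (auto simp: d)
    also have "\<dots> = (B + B') * conv P Q k"
      by (simp add: conv_def sum_distrib_left mult_ac)
    finally show ?thesis using cp[of k] by simp
  qed
  \<comment> \<open>The second moment of the sum of the two scores on the event that the two
    variables add up to k.\<close>
  let ?S = "\<lambda>k. \<Sum>i\<le>k. ?w k i * (score P i + score Q (k - i))\<^sup>2"
  have sq_le: "(score (conv P Q) k)\<^sup>2 * conv P Q k \<le> ?S k" for k
  proof -
    \<comment> \<open>Jensen's inequality for the conditional expectation, in a form free of
      division.\<close>
    have "(score (conv P Q) k * conv P Q k)\<^sup>2 \<le> conv P Q k * ?S k"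
      unfolding score_conv[OF Pp Qp] unfolding conv_def
      using nn by (intro weighted_Cauchy_Schwarz) auto
    then have "conv P Q k * ((score (conv P Q) k)\<^sup>2 * conv P Q k) \<le> conv P Q k * ?S k"
      by (simp add: power2_eq_square mult_ac)
    then show ?thesis using cp[of k] by simp
  qed
  \<comment> \<open>Independence turns the cross term into the product of the means; (m + m')^2
    absorbs it, and the variance bounds add.\<close>
  have S: "?S sums (?J P + 2 * (m * m') + ?J Q)"
  proof -
    have "(\<lambda>k. conv (\<lambda>k. (score P k)\<^sup>2 * P k) Q k
         + 2 * conv (\<lambda>k. score P k * P k) (\<lambda>k. score Q k * Q k) k
         + conv P (\<lambda>k. (score Q k)\<^sup>2 * Q k) k) sums (?J P * 1 + 2 * (m * m') + 1 * ?J Q)"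
      using P Q nn by (intro sums_add conv_sums sums_mult summable_sums) (auto simp: d)
    also have "(\<lambda>k. conv (\<lambda>k. (score P k)\<^sup>2 * P k) Q k
         + 2 * conv (\<lambda>k. score P k * P k) (\<lambda>k. score Q k * Q k) k
         + conv P (\<lambda>k. (score Q k)\<^sup>2 * Q k) k) = ?S"
      by (simp add: conv_def fun_eq_iff power2_eq_square algebra_simps sum.distrib sum_distrib_left)
    finally show ?thesis by simp
  qed
  have sm: "summable (\<lambda>k. (score (conv P Q) k)\<^sup>2 * conv P Q k)"
    by (rule summable_comparison_test'[OF sums_summable[OF S], of 0])
       (use sq_le cp in \<open>auto simp: less_imp_le\<close>)
  have "?J (conv P Q) \<le> ?J P + 2 * (m * m') + ?J Q"
    using suminf_le[OF sq_le sm sums_summable[OF S]] sums_unique[OF S] by simp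
  also have "\<dots> \<le> (m + m')\<^sup>2 + (V + V')"
    using P Q by (simp add: d power2_sum)
  finally show ?thesis
    using cp one mean bound sm by (simp add: d)
qed

section \<open>Bounding the variance of the score, and the entropy by it\<close>

lemma score_boundsI:
  assumes "\<And>k. P k > 0" "P sums 1" "(\<lambda>k. real (Suc k) * P (Suc k)) sums m" "\<And>k. score P k \<le> B"
  shows "score_bounds P m (m * (B - m)) B"
proof -
  have nn: "score P k \<ge> 0" for k by (rule score_nonneg) (rule assms)
  have mean: "(\<lambda>k. score P k * P k) sums m"
    using assms(3) by (simp only: score_mult[of P, OF assms(1)])
  \<comment> \<open>S^2 <= B S for 0 <= S <= B, so the variance is at most B m - m^2.\<close>
  have le: "(score P k)\<^sup>2 * P k \<le> B * (score P k * P k)" for k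
    using nn[of k] assms(4)[of k] assms(1)[of k]
    by (simp add: power2_eq_square mult.assoc mult_right_mono)
  have B: "(\<lambda>k. B * (score P k * P k)) sums (B * m)"
    by (intro sums_mult mean)
  have sm: "summable (\<lambda>k. (score P k)\<^sup>2 * P k)"
    by (rule summable_comparison_test'[OF sums_summable[OF B], of 0])
       (use le assms(1) in \<open>auto simp: less_imp_le\<close>)
  have "(\<Sum>k. (score P k)\<^sup>2 * P k) \<le> B * m"
    using suminf_le[OF le sm sums_summable[OF B]] sums_unique[OF B] by simp
  then show ?thesis
    using assms mean sm by (simp add: score_bounds_def power2_eq_square algebra_simps)
qed

text \<open>The energy in the logarithmic Sobolev inequality is the mean of (score / T - 1)^2 under
  \<open>P\<close>, which is at most V / T^2 because the score has mean T.\<close>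

lemma poisson_entropy_le_score_variance:
  fixes T :: real
  assumes T: "T > 0" and P: "score_bounds P T V B"
  defines "g \<equiv> \<lambda>k. P k / pmf (poisson_pmf T) k"
  shows "summable (\<lambda>k. \<bar>g k * ln (g k) * pmf (poisson_pmf T) k\<bar>)"
    and "(\<Sum>k. g k * ln (g k) * pmf (poisson_pmf T) k) \<le> V / T"
proof -
  note d = score_bounds_def
  have Pp: "P k > 0" for k using P by (auto simp: d)
  have pp: "pmf (poisson_pmf T) k > 0" for k using T by simp
  have gp: "g k > 0" for k using Pp pp by (simp add: g_def)
  have gP: "pmf (poisson_pmf T) k * g k = P k" for k using pp[of k] by (simp add: g_def)
  have gS: "g (Suc k) = score P k / T * g k" for k
    using T Pp[of k] by (simp add: g_def score_def field_simps)
  have sc: "0 \<le> score P k" "score P k \<le> B" for k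
    using P score_nonneg Pp by (auto simp: d)
  \<comment> \<open>A bounded score makes the density grow at most geometrically, as the limit
    argument requires.\<close>
  have g_le: "g k \<le> g 0 * (B / T) ^ k" for k
  proof (induction k)
    case (Suc k)
    have "g (Suc k) \<le> B / T * g k"
      unfolding gS using sc[of k] T gp[of k] by (intro mult_right_mono divide_right_mono) auto
    also have "\<dots> \<le> B / T * (g 0 * (B / T) ^ k)"
      using Suc sc[of k] T by (intro mult_left_mono) auto
    finally show ?case by (simp add: mult_ac)
  qed simp
  have G: "(g (Suc k) - g k)\<^sup>2 / g k = (score P k / T - 1)\<^sup>2 * g k" for k
    unfolding gS using gp[of k] by (simp add: field_simps power2_eq_square)
  have D_le: "(g (Suc k) - g k)\<^sup>2 / g k \<le> ((B / T + 1)\<^sup>2 * g 0) * (B / T) ^ k" for k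
  proof -
    have "score P k / T \<le> B / T" "score P k / T \<ge> 0" using sc[of k] T by (auto intro: divide_right_mono)
    then have "(score P k / T - 1)\<^sup>2 \<le> (B / T + 1)\<^sup>2"
      by (intro power2_le_iff_abs_le[THEN iffD2]) auto
    then have "(score P k / T - 1)\<^sup>2 * g k \<le> (B / T + 1)\<^sup>2 * (g 0 * (B / T) ^ k)"
      using g_le gp[of k] by (intro mult_mono) auto
    then show ?thesis by (simp add: G mult_ac)
  qed
  have mean: "(\<Sum>k. pmf (poisson_pmf T) k * g k) = 1"
    unfolding gP using P by (auto simp: d sums_iff)
  note L = poisson_log_sobolev[OF T gp g_le D_le mean]
  have c: "(\<lambda>k. g k * ln (g k) * pmf (poisson_pmf T) k) = (\<lambda>k. pmf (poisson_pmf T) k * (g k * ln (g k)))"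
    by (simp add: mult_ac)
  show "summable (\<lambda>k. \<bar>g k * ln (g k) * pmf (poisson_pmf T) k\<bar>)"
    using L(1) by (simp add: mult_ac)
  let ?J = "\<Sum>k. (score P k)\<^sup>2 * P k"
  have "(\<lambda>k. (score P k)\<^sup>2 * P k / T\<^sup>2 - 2 * (score P k * P k / T) + P k) sums (?J / T\<^sup>2 - 2 * (T / T) + 1)"
    using P by (intro sums_add sums_diff sums_mult sums_divide summable_sums) (auto simp: d)
  also have "(\<lambda>k. (score P k)\<^sup>2 * P k / T\<^sup>2 - 2 * (score P k * P k / T) + P k)
      = (\<lambda>k. pmf (poisson_pmf T) k * ((g (Suc k) - g k)\<^sup>2 / g k))"
  proof
    fix k
    have "pmf (poisson_pmf T) k * ((g (Suc k) - g k)\<^sup>2 / g k) = (score P k / T - 1)\<^sup>2 * P k"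
      unfolding G gP[symmetric] by simp
    then show "(score P k)\<^sup>2 * P k / T\<^sup>2 - 2 * (score P k * P k / T) + P k
        = pmf (poisson_pmf T) k * ((g (Suc k) - g k)\<^sup>2 / g k)"
      by (simp add: power2_eq_square algebra_simps)
  qed
  finally have F: "(\<Sum>k. pmf (poisson_pmf T) k * ((g (Suc k) - g k)\<^sup>2 / g k)) = ?J / T\<^sup>2 - 1"
    using T by (simp add: sums_iff)
  have "(\<Sum>k. g k * ln (g k) * pmf (poisson_pmf T) k) \<le> T * (?J / T\<^sup>2 - 1)"
    using L(2) unfolding c F .
  also have "\<dots> \<le> T * ((T\<^sup>2 + V) / T\<^sup>2 - 1)"
    using P T by (intro mult_left_mono diff_right_mono divide_right_mono) (auto simp: d)
  also have "\<dots> = V / T" using T by (simp add: field_simps power2_eq_square)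
  finally show "(\<Sum>k. g k * ln (g k) * pmf (poisson_pmf T) k) \<le> V / T" .
qed

section \<open>Thinning\<close>

definition thinned :: "real \<Rightarrow> (nat \<Rightarrow> real) \<Rightarrow> nat \<Rightarrow> real" where
  "thinned a p k = (\<Sum>m. p m * (real (m choose k) * a ^ k * (1 - a) ^ (m - k)))"

lemma binom_op_one: "binom_op p N (\<lambda>_. 1) = 1"
  by (induction N) (simp_all add: binom_op_Suc, simp add: binom_op_def)

lemma binom_op_real: "binom_op p N real = real N * p"
proof (induction N)
  case (Suc N)
  have "binom_op p (Suc N) real = binom_op p N (\<lambda>k. real k + p * 1)"
    unfolding binom_op_Suc by (simp add: algebra_simps)
  also have "\<dots> = real (Suc N) * p"
    unfolding binom_op_add binom_op_cmult Suc binom_op_one by (simp add: algebra_simps)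
  finally show ?case .
qed (simp add: binom_op_def)

lemma binomial_weight_le_1:
  fixes a :: real
  assumes "0 \<le> a" "a \<le> 1"
  shows "real (m choose k) * a ^ k * (1 - a) ^ (m - k) \<le> 1"
proof -
  let ?b = "\<lambda>k. real (m choose k) * a ^ k * (1 - a) ^ (m - k)"
  have nn: "0 \<le> ?b k" for k using assms by simp
  show "?b k \<le> 1"
  proof (cases "k \<le> m")
    case True
    have "?b k \<le> sum ?b {..m}"
      using True nn by (intro member_le_sum) auto
    also have "\<dots> = 1" using binom_op_one[of a m] by (simp add: binom_op_def)
    finally show ?thesis .
  qed (simp add: not_le binomial_eq_0)
qed

lemma ennreal_suminf_swap:
  fixes f :: "nat \<Rightarrow> nat \<Rightarrow> ennreal"
  shows "(\<Sum>i. \<Sum>j. f i j) = (\<Sum>j. \<Sum>i. f i j)"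
proof -
  have "(\<Sum>i. \<Sum>j. f i j) = (\<Sum>i. \<integral>\<^sup>+j. f i j \<partial>count_space UNIV)"
    by (simp add: nn_integral_count_space_nat)
  also have "\<dots> = (\<integral>\<^sup>+j. (\<Sum>i. f i j) \<partial>count_space UNIV)"
    by (rule nn_integral_suminf[symmetric]) simp
  finally show ?thesis by (simp add: nn_integral_count_space_nat)
qed

section \<open>Total mass and mean of a thinned law\<close>

context
  fixes p :: "nat \<Rightarrow> real" and a :: real
  assumes p: "\<And>k. p k > 0" "p sums 1" and a: "0 < a" "a < 1"
begin

lemma summable_thinned:
  "summable (\<lambda>m. p m * (real (m choose k) * a ^ k * (1 - a) ^ (m - k)))"
proof (rule summable_comparison_test'[of p 0])
  show "summable p" using p by (auto simp: sums_iff)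
  show "norm (p m * (real (m choose k) * a ^ k * (1 - a) ^ (m - k))) \<le> p m" for m
    using mult_left_mono[OF binomial_weight_le_1[of a m k], of "p m"] p(1)[of m] a
    by (simp add: abs_mult less_imp_le)
qed

text \<open>Given the value m of the original variable, \<open>\<phi>\<close> is averaged over a
  binomial law. The two sums are exchanged in \<open>ennreal\<close>, without prior summability. The
  constant 1 and the identity for \<open>\<phi>\<close> give mass and mean.\<close>

lemma thinned_weighted_sums:
  assumes \<phi>: "\<And>k. \<phi> k \<ge> 0" and L: "(\<lambda>m. p m * binom_op a m \<phi>) sums L"
  shows "(\<lambda>k. \<phi> k * thinned a p k) sums L"
proof -
  let ?b = "\<lambda>m k. real (m choose k) * a ^ k * (1 - a) ^ (m - k)"
  have b: "?b m k \<ge> 0" for m k using a by simp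
  have t: "thinned a p k \<ge> 0" for k
    unfolding thinned_def using p(1) b by (intro suminf_nonneg summable_thinned) (auto simp: less_imp_le)
  have B: "binom_op a m \<phi> \<ge> 0" for m
    unfolding binom_op_def using b \<phi> by (intro sum_nonneg mult_nonneg_nonneg[OF b]) auto
  have pB: "p m * binom_op a m \<phi> \<ge> 0" for m using p(1)[of m] B[of m] by simp
  have L0: "L \<ge> 0" using L pB by (auto simp: sums_iff intro!: suminf_nonneg)
  have "(\<Sum>k. ennreal (\<phi> k * thinned a p k)) = (\<Sum>k. \<Sum>m. ennreal (\<phi> k * (p m * ?b m k)))"
  proof (intro suminf_cong)
    fix k
    have "\<phi> k * thinned a p k = (\<Sum>m. \<phi> k * (p m * ?b m k))"
      unfolding thinned_def by (rule suminf_mult[symmetric, OF summable_thinned])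
    moreover have "(\<Sum>m. ennreal (\<phi> k * (p m * ?b m k))) = ennreal (\<Sum>m. \<phi> k * (p m * ?b m k))"
      using b p(1) \<phi> by (intro suminf_ennreal2 summable_mult summable_thinned) (auto simp: less_imp_le)
    ultimately show "ennreal (\<phi> k * thinned a p k) = (\<Sum>m. ennreal (\<phi> k * (p m * ?b m k)))"
      by simp
  qed
  also have "\<dots> = (\<Sum>m. \<Sum>k. ennreal (\<phi> k * (p m * ?b m k)))"
    by (rule ennreal_suminf_swap)
  also have "\<dots> = (\<Sum>m. ennreal (p m * binom_op a m \<phi>))"
  proof (intro suminf_cong)
    fix m
    have "(\<Sum>k. ennreal (\<phi> k * (p m * ?b m k))) = (\<Sum>k\<le>m. ennreal (\<phi> k * (p m * ?b m k)))"
      by (intro suminf_finite) (auto simp: not_le binomial_eq_0)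
    also have "\<dots> = ennreal (\<Sum>k\<le>m. \<phi> k * (p m * ?b m k))"
      using b p(1) \<phi> by (intro sum_ennreal) (auto simp: less_imp_le)
    also have "(\<Sum>k\<le>m. \<phi> k * (p m * ?b m k)) = p m * binom_op a m \<phi>"
      by (simp add: binom_op_def sum_distrib_left mult_ac)
    finally show "(\<Sum>k. ennreal (\<phi> k * (p m * ?b m k))) = ennreal (p m * binom_op a m \<phi>)" .
  qed
  also have "\<dots> = ennreal L"
    using L pB by (subst suminf_ennreal2) (auto simp: sums_iff)
  finally have "(\<lambda>k. ennreal (\<phi> k * thinned a p k)) sums ennreal L"
    using summable_sums[OF summableI] by metis
  then show ?thesis
    using sums_ennreal[of "\<lambda>k. \<phi> k * thinned a p k" L] t \<phi> L0 by simp
qed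

lemma thinned_sums: "thinned a p sums 1"
  using thinned_weighted_sums[of "\<lambda>_. 1" 1] p(2) by (simp add: binom_op_one)

lemma thinned_mean:
  assumes "(\<lambda>m. real m * p m) sums T"
  shows "(\<lambda>k. real (Suc k) * thinned a p (Suc k)) sums (a * T)"
proof -
  have "(\<lambda>k. real k * thinned a p k) sums (a * T)"
    by (rule thinned_weighted_sums)
       (use sums_mult[OF assms, of a] in \<open>simp_all add: binom_op_real mult_ac\<close>)
  then show ?thesis
    using sums_Suc_iff[of "\<lambda>k. real k * thinned a p k" "a * T"] by simp
qed

end

text \<open>Chebyshev's association argument: j - c changes sign just after the integer part
  \<open>N\<close> of \<open>c\<close>, so the decreasing weight \<open>h j\<close> may be replaced
  by the constant \<open>h N\<close>, for which the bound is the hypothesis.\<close>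

lemma weighted_Chebyshev_antimono:
  fixes w h :: "nat \<Rightarrow> real"
  assumes w: "\<And>j. w j \<ge> 0" and h: "\<And>j. h j \<ge> 0" "decseq h"
    and sm: "summable w" "summable (\<lambda>j. real j * w j)"
    and c: "c \<ge> 0" "(\<Sum>j. real j * w j) \<le> c * (\<Sum>j. w j)"
  shows "summable (\<lambda>j. w j * h j)" "summable (\<lambda>j. real j * (w j * h j))"
    "(\<Sum>j. real j * (w j * h j)) \<le> c * (\<Sum>j. w j * h j)"
proof -
  have h0: "h j \<le> h 0" for j using h by (auto simp: decseq_def)
  show s1: "summable (\<lambda>j. w j * h j)"
    by (rule summable_comparison_test'[OF summable_mult2[OF sm(1), of "h 0"], of 0])
       (use w h h0 in \<open>auto intro!: mult_mono\<close>)
  show s2: "summable (\<lambda>j. real j * (w j * h j))"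
    by (rule summable_comparison_test'[OF summable_mult2[OF sm(2), of "h 0"], of 0])
       (use w h h0 in \<open>auto simp: mult.assoc intro!: mult_left_mono mult_mono\<close>)
  define N where "N = nat \<lfloor>c\<rfloor>"
  have N: "real N \<le> c" "c < real N + 1" using c(1) by (auto simp: N_def)
  \<comment> \<open>\<open>j - c\<close> and \<open>h j - h N\<close> have opposite signs\<close>
  have le: "real j * (w j * h j) - c * (w j * h j) \<le> h N * (real j * w j - c * w j)" for j
  proof -
    have "(real j - c) * h j \<le> (real j - c) * h N"
    proof (cases "j \<le> N")
      case True
      then have "real j - c \<le> 0" "h N \<le> h j" using N h by (auto simp: decseq_def)
      then show ?thesis by (rule mult_left_mono_neg[rotated])
    next
      case False
      then have "real j - c \<ge> 0" "h j \<le> h N" using N h by (auto simp: decseq_def)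
      then show ?thesis by (intro mult_left_mono) auto
    qed
    from mult_left_mono[OF this w[of j]] show ?thesis by (simp add: algebra_simps)
  qed
  have "(\<Sum>j. real j * (w j * h j)) - c * (\<Sum>j. w j * h j)
      = (\<Sum>j. real j * (w j * h j) - c * (w j * h j))"
    using s1 s2 by (simp add: suminf_diff[symmetric] suminf_mult[symmetric] summable_mult)
  also have "\<dots> \<le> (\<Sum>j. h N * (real j * w j - c * w j))"
    using s1 s2 sm by (intro suminf_le le summable_diff summable_mult) auto
  also have "\<dots> = h N * ((\<Sum>j. real j * w j) - c * (\<Sum>j. w j))"
    using sm by (subst suminf_mult) (simp_all add: suminf_diff[symmetric] suminf_mult[symmetric] summable_mult summable_diff)
  also have "\<dots> \<le> 0" using c h by (intro mult_nonneg_nonpos) auto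
  finally show "(\<Sum>j. real j * (w j * h j)) \<le> c * (\<Sum>j. w j * h j)" by simp
qed

text \<open>With s = 1 - a, the tilted weights are, up to normalisation, the law of X given that its
  a-thinning is 0. For T >= 1 the factor s + (1 - s) T is at least 1, and the Chebyshev bound by T
  suffices. For T < 1 the numerator is at most s T, and Bernoulli's inequality bounds the
  normalisation below by 1 - (1 - s) T.\<close>

lemma geometric_tilt_mean_le:
  fixes p :: "nat \<Rightarrow> real"
  assumes p: "\<And>k. p k \<ge> 0" "p sums 1" "(\<lambda>m. real m * p m) sums T"
    and s: "0 < s" "s < 1"
  shows "summable (\<lambda>j. p j * s ^ j)" "summable (\<lambda>j. real j * (p j * s ^ j))"
    "(\<Sum>j. real j * (p j * s ^ j)) \<le> T * (s + (1 - s) * T) * (\<Sum>j. p j * s ^ j)"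
proof -
  have T: "T \<ge> 0" using p by (auto simp: sums_iff intro!: suminf_nonneg)
  have dec: "decseq (\<lambda>j. s ^ j)" using s by (auto simp: decseq_def intro!: power_decreasing)
  have sp: "summable p" "summable (\<lambda>j. real j * p j)" "suminf p = 1" "(\<Sum>j. real j * p j) = T"
    using p by (auto simp: sums_iff)
  note C = weighted_Chebyshev_antimono[of p "\<lambda>j. s ^ j" T, OF p(1) _ dec sp(1,2) T]
  show s1: "summable (\<lambda>j. p j * s ^ j)" using C(1) s sp by simp
  show s2: "summable (\<lambda>j. real j * (p j * s ^ j))" using C(2) s sp by simp
  let ?G = "\<Sum>j. p j * s ^ j"
  have G0: "?G \<ge> 0" using s1 s p by (intro suminf_nonneg) auto
  show "(\<Sum>j. real j * (p j * s ^ j)) \<le> T * (s + (1 - s) * T) * ?G"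
  proof (cases "T \<ge> 1")
    case True
    have "s + (1 - s) * 1 \<le> s + (1 - s) * T"
      using True s by (intro add_left_mono mult_left_mono) auto
    then have "T * 1 * ?G \<le> T * (s + (1 - s) * T) * ?G"
      using T G0 by (intro mult_right_mono mult_left_mono) auto
    moreover have "(\<Sum>j. real j * (p j * s ^ j)) \<le> T * ?G" using C(3) s sp by simp
    ultimately show ?thesis by simp
  next
    case False
    have B: "1 - real j * (1 - s) \<le> s ^ j" for j
      using Bernoulli_inequality[of "s - 1" j] s by (simp add: algebra_simps)
    have "(\<Sum>j. p j - (1 - s) * (real j * p j)) \<le> ?G"
    proof (intro suminf_le s1 summable_diff summable_mult sp)
      show "p j - (1 - s) * (real j * p j) \<le> p j * s ^ j" for j
        using mult_left_mono[OF B[of j] p(1)[of j]] by (simp add: algebra_simps)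
    qed
    also have "(\<Sum>j. p j - (1 - s) * (real j * p j)) = 1 - (1 - s) * T"
      using sp by (simp add: suminf_diff[symmetric] suminf_mult summable_mult)
    finally have G: "1 - (1 - s) * T \<le> ?G" .
    have "real j * (p j * s ^ j) \<le> s * (real j * p j)" for j
    proof (cases j)
      case (Suc i)
      have "s ^ j \<le> s" using Suc s by (simp add: mult_le_cancel_left1 power_le_one)
      from mult_left_mono[OF this, of "real j * p j"] p(1)[of j] show ?thesis by (simp add: mult_ac)
    qed simp
    then have "(\<Sum>j. real j * (p j * s ^ j)) \<le> (\<Sum>j. s * (real j * p j))"
      by (intro suminf_le s2 summable_mult sp) auto
    also have "\<dots> = s * T" using sp by (simp add: suminf_mult)
    also have "\<dots> \<le> T * (s + (1 - s) * T) * (1 - (1 - s) * T)"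
    proof -
      \<comment> \<open>The gap between the two sides; T < 1 makes it nonnegative.\<close>
      have "(s + (1 - s) * T) * (1 - (1 - s) * T) - s = (1 - s)\<^sup>2 * T * (1 - T)"
        by (simp add: power2_eq_square algebra_simps)
      moreover have "\<dots> \<ge> 0" using False T by simp
      ultimately have "s \<le> (s + (1 - s) * T) * (1 - (1 - s) * T)" by linarith
      from mult_left_mono[OF this T] show ?thesis by (simp add: mult_ac)
    qed
    also have "\<dots> \<le> T * (s + (1 - s) * T) * ?G"
      using G T s by (intro mult_left_mono) auto
    finally show ?thesis .
  qed
qed

text \<open>Up to the factor \<open>a ^ k / fact k\<close>, the thinned law at \<open>k\<close> is the total mass of the tilted weights
  \<open>p j * (1 - a) ^ j\<close> reweighted by the antimonotone likelihood ratio of \<open>ulc\<close>, and its score is a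
  multiple of the mean of the reweighted law.\<close>
lemma thinned_score_bounds:
  fixes p :: "nat \<Rightarrow> real"
  assumes p: "\<And>k. p k > 0" "p sums 1" "(\<lambda>m. real m * p m) sums T"
    and ulc: "\<And>k. decseq (\<lambda>j. (fact (j + k) * p (j + k)) / (fact j * p j))"
    and a: "0 < a" "a < 1"
  shows "score_bounds (thinned a p) (a * T) ((a * T)\<^sup>2 * (a * T / (1 - a))) (a * T * (1 + a * T / (1 - a)))"
proof -
  define s where "s = 1 - a"
  have s: "0 < s" "s < 1" using a by (auto simp: s_def)
  have pn: "p k \<ge> 0" for k using p(1)[of k] by simp
  have T: "T \<ge> 0" using p pn by (auto simp: sums_iff intro!: suminf_nonneg)
  define c where "c = T * (s + (1 - s) * T)"
  have c0: "c \<ge> 0" using T s by (simp add: c_def)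
  \<comment> \<open>Up to the factor \<open>a ^ k / fact k\<close>, this is the probability that X =
    j + k and exactly k of its units are retained.\<close>
  define F where "F k j = fact (j + k) * p (j + k) * s ^ j / fact j" for k j
  have Fp: "F k j > 0" for k j using p s by (simp add: F_def)
  note G = geometric_tilt_mean_le[OF pn p(2,3) s]
  have F_tilt: "p j * s ^ j * ((fact (j + k) * p (j + k)) / (fact j * p j)) = F k j" for j k
    using p(1)[of j] by (simp add: F_def field_simps)
  note C = weighted_Chebyshev_antimono[of "\<lambda>j. p j * s ^ j" "\<lambda>j. (fact (j + k) * p (j + k)) / (fact j * p j)" c for k,
      OF _ _ ulc G(1,2) c0, unfolded F_tilt]
  have Fs: "summable (F k)" for k using C(1)[of k] p pn s G(3) by (simp add: c_def)
  \<comment> \<open>By this shift the first moment of \<open>F k\<close> is s times the total mass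
    of \<open>F (Suc k)\<close>, so a bound on means becomes a bound on ratios of consecutive
    masses.\<close>
  have F_Suc: "real (Suc j) * F k (Suc j) = s * F (Suc k) j" for k j
    by (simp add: F_def field_simps del: of_nat_Suc)
  have ratio: "s * suminf (F (Suc k)) \<le> c * suminf (F k)" for k
  proof -
    have s2: "summable (\<lambda>j. real j * F k j)" using C(2)[of k] p pn s G(3) by (simp add: c_def)
    have "(\<Sum>j. real j * F k j) = (\<Sum>j. real (Suc j) * F k (Suc j))"
      using suminf_split_head[OF s2] by simp
    also have "\<dots> = s * suminf (F (Suc k))"
      unfolding F_Suc using Fs by (simp add: suminf_mult)
    finally show ?thesis
      using C(3)[of k] p pn s G(3) by (simp add: c_def)
  qed
  have thF: "thinned a p k = a ^ k / fact k * suminf (F k)" for k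
  proof -
    have "thinned a p k = (\<Sum>j. p (j + k) * (real ((j + k) choose k) * a ^ k * (1 - a) ^ j))
        + (\<Sum>m<k. p m * (real (m choose k) * a ^ k * (1 - a) ^ (m - k)))"
      unfolding thinned_def
      by (subst suminf_split_initial_segment[OF summable_thinned[OF p(1,2) a], of _ k]) simp
    also have "(\<Sum>m<k. p m * (real (m choose k) * a ^ k * (1 - a) ^ (m - k))) = 0"
      by (intro sum.neutral) auto
    also have "(\<lambda>j. p (j + k) * (real ((j + k) choose k) * a ^ k * (1 - a) ^ j)) = (\<lambda>j. a ^ k / fact k * F k j)"
      by (simp add: fun_eq_iff F_def s_def binomial_fact field_simps)
    also have "(\<Sum>j. a ^ k / fact k * F k j) = a ^ k / fact k * suminf (F k)"
      by (rule suminf_mult[OF Fs])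
    finally show ?thesis by simp
  qed
  have sF: "suminf (F k) > 0" for k using Fs Fp by (intro suminf_pos)
  have pos: "thinned a p k > 0" for k unfolding thF using a sF by simp
  have "score (thinned a p) k \<le> a * T * (1 + a * T / (1 - a))" for k
  proof -
    have "score (thinned a p) k = a * (suminf (F (Suc k)) / suminf (F k))"
      using a sF[of k] by (simp add: score_def thF field_simps del: of_nat_Suc)
    also have "suminf (F (Suc k)) / suminf (F k) \<le> c / s"
      using ratio[of k] sF[of k] s by (simp add: field_simps)
    also have "c / s = T * (1 + a * T / (1 - a))"
      using s by (simp add: c_def s_def field_simps)
    finally show ?thesis using a by simp
  qed
  \<comment> \<open>With m = a T and b the bound on the score, b - m is (a T)^2 / (1 - a).\<close>
  from score_boundsI[OF pos thinned_sums[OF p(1,2) a] thinned_mean[OF p(1,2) a p(3)] this]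
  show ?thesis by (simp add: power2_eq_square algebra_simps)
qed

text \<open>The ratio over k steps is a product of k one-step ratios, each decreasing by
  log-concavity. The induction on k uses the cross-multiplied form and cancels
  \<open>f (j + k)\<close>.\<close>

lemma log_concave_ratio_decseq:
  assumes lc: "log_concave f" and f: "\<And>k. f k > 0"
  shows "decseq (\<lambda>j. f (j + k) / f j)"
proof (rule decseq_SucI)
  fix j
  have "f (Suc j + k) * f j \<le> f (j + k) * f (Suc j)"
  proof (induction k)
    case (Suc k)
    have "f (Suc j + Suc k) * f (j + k) \<le> (f (Suc j + k))\<^sup>2"
      using lc[unfolded log_concave_def, rule_format, of "Suc j + k"] by simp
    then have "f (Suc j + Suc k) * f j * f (j + k) \<le> f (Suc j + k) * (f (Suc j + k) * f j)"
      using mult_right_mono[of _ _ "f j"] f[of j] by (force simp: power2_eq_square mult_ac)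
    also have "\<dots> \<le> f (Suc j + k) * (f (j + k) * f (Suc j))"
      using f[of "Suc j + k"] by (intro mult_left_mono Suc) auto
    finally have "f (Suc j + Suc k) * f j * f (j + k) \<le> f (Suc j + k) * f (Suc j) * f (j + k)"
      by (simp add: mult_ac)
    then show ?case using f[of "j + k"] by simp
  qed simp
  then show "f (Suc j + k) / f (Suc j) \<le> f (j + k) / f j"
    using f[of j] f[of "Suc j"] by (simp add: field_simps)
qed

section \<open>Laws of sums and thinnings\<close>

context prob_space
begin

text \<open>After embedding into the reals, one variable is independent of the sum of the others;
  singletons recover the events.\<close>

lemma indep_sum_nat:
  fixes Y :: "'i \<Rightarrow> 'a \<Rightarrow> nat"
  assumes "finite J" "i \<notin> J" "indep_vars (\<lambda>_. count_space UNIV) Y (insert i J)"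
  shows "prob {\<omega> \<in> space M. Y i \<omega> = x \<and> (\<Sum>j\<in>J. Y j \<omega>) = k}
    = prob {\<omega> \<in> space M. Y i \<omega> = x} * prob {\<omega> \<in> space M. (\<Sum>j\<in>J. Y j \<omega>) = k}"
proof -
  have "indep_vars (\<lambda>_. borel) (\<lambda>i \<omega>. real (Y i \<omega>)) (insert i J)"
    by (rule indep_vars_compose2[OF assms(3)]) auto
  from indep_vars_sum[OF assms(1,2) this]
  have "indep_var borel (\<lambda>\<omega>. real (Y i \<omega>)) borel (\<lambda>\<omega>. \<Sum>j\<in>J. real (Y j \<omega>))" .
  from indep_varD[OF this, of "{real x}" "{real k}"]
  show ?thesis
    by (simp add: vimage_def Int_def conj_commute conj_left_commute flip: of_nat_sum)
qed

lemma law_add_eq_conv: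
  fixes U W :: "'a \<Rightarrow> nat"
  assumes [measurable]: "U \<in> measurable M (count_space UNIV)" "W \<in> measurable M (count_space UNIV)"
    and "\<And>x k. prob {\<omega> \<in> space M. U \<omega> = x \<and> W \<omega> = k}
        = prob {\<omega> \<in> space M. U \<omega> = x} * prob {\<omega> \<in> space M. W \<omega> = k}"
  shows "prob {\<omega> \<in> space M. U \<omega> + W \<omega> = k}
    = conv (\<lambda>x. prob {\<omega> \<in> space M. U \<omega> = x}) (\<lambda>x. prob {\<omega> \<in> space M. W \<omega> = x}) k"
proof -
  have "{\<omega> \<in> space M. U \<omega> + W \<omega> = k} = (\<Union>i\<le>k. {\<omega> \<in> space M. U \<omega> = i \<and> W \<omega> = k - i})"
    by auto
  also have "prob \<dots> = (\<Sum>i\<le>k. prob {\<omega> \<in> space M. U \<omega> = i \<and> W \<omega> = k - i})"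
    by (intro finite_measure_finite_Union) (auto simp: disjoint_family_on_def)
  finally show ?thesis by (simp add: assms conv_def)
qed

lemma indep_vars_nat_measurable:
  "indep_vars (\<lambda>_. count_space UNIV) Y I \<Longrightarrow> i \<in> I \<Longrightarrow> Y i \<in> measurable M (count_space UNIV)"
  by (auto simp: indep_vars_def)

lemma measurable_sum_nat:
  fixes Y :: "'i \<Rightarrow> 'a \<Rightarrow> nat"
  assumes "\<And>j. j \<in> J \<Longrightarrow> Y j \<in> measurable M (count_space UNIV)"
  shows "(\<lambda>\<omega>. \<Sum>j\<in>J. Y j \<omega>) \<in> measurable M (count_space UNIV)"
  using assms borel_measurable_sum[of J Y M]
  by (simp add: measurable_cong_sets[OF refl sets_borel_eq_count_space])

lemma law_indep_sum_insert:
  fixes Y :: "'i \<Rightarrow> 'a \<Rightarrow> nat"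
  assumes "finite J" "i \<notin> J" "indep_vars (\<lambda>_. count_space UNIV) Y (insert i J)"
  shows "prob {\<omega> \<in> space M. (\<Sum>j\<in>insert i J. Y j \<omega>) = k}
    = conv (\<lambda>x. prob {\<omega> \<in> space M. Y i \<omega> = x}) (\<lambda>x. prob {\<omega> \<in> space M. (\<Sum>j\<in>J. Y j \<omega>) = x}) k"
  using law_add_eq_conv[of "Y i" "\<lambda>\<omega>. \<Sum>j\<in>J. Y j \<omega>" k] indep_sum_nat[OF assms]
    indep_vars_nat_measurable[OF assms(3)] assms(1,2)
  by (simp add: measurable_sum_nat)

text \<open>Each further summand convolves the law with a two-point law, and Pascal's rule closes
  the induction.\<close>

lemma law_bernoulli_sum:
  fixes B :: "nat \<Rightarrow> 'a \<Rightarrow> nat"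
  assumes ind: "indep_vars (\<lambda>_. count_space UNIV) B {1..}"
    and ber: "\<And>j. j \<ge> 1 \<Longrightarrow> prob {\<omega> \<in> space M. B j \<omega> = 1} = a"
      "\<And>j. j \<ge> 1 \<Longrightarrow> prob {\<omega> \<in> space M. B j \<omega> = 0} = 1 - a"
  shows "prob {\<omega> \<in> space M. (\<Sum>j=1..m. B j \<omega>) = k} = real (m choose k) * a ^ k * (1 - a) ^ (m - k)"
proof (induction m arbitrary: k)
  case 0
  show ?case by (cases k) (simp_all add: prob_space)
next
  case (Suc m)
  let ?b = "\<lambda>m k. real (m choose k) * a ^ k * (1 - a) ^ (m - k)"
  let ?q = "\<lambda>x. prob {\<omega> \<in> space M. B (Suc m) \<omega> = x}"
  have [measurable]: "B (Suc m) \<in> measurable M (count_space UNIV)"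
    by (rule indep_vars_nat_measurable[OF ind]) simp
  have q: "?q 0 = 1 - a" "?q (Suc 0) = a" using ber[of "Suc m"] by simp_all
  \<comment> \<open>The prescribed probabilities of 0 and 1 add up to 1, so no mass is left for
    other values.\<close>
  have q0: "?q x = 0" if "x \<ge> 2" for x
  proof -
    have "?q x + (?q 0 + ?q 1) = measure M (\<Union>i\<in>{x, 0, 1}. {\<omega> \<in> space M. B (Suc m) \<omega> = i})"
      using that by (subst finite_measure_finite_Union) (auto simp: disjoint_family_on_def)
    also have "\<dots> \<le> 1" by simp
    finally show ?thesis using q measure_nonneg[of M "{\<omega> \<in> space M. B (Suc m) \<omega> = x}"] by simp
  qed
  have e: "{1..Suc m} = insert (Suc m) {1..m}" by auto
  have "prob {\<omega> \<in> space M. (\<Sum>j=1..Suc m. B j \<omega>) = k} = conv ?q (?b m) k"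
    unfolding e by (subst law_indep_sum_insert)
      (auto intro: indep_vars_subset[OF ind] simp: Suc[unfolded One_nat_def])
  also have "\<dots> = ?b (Suc m) k"
  proof (cases k)
    case 0
    then show ?thesis using q by (simp add: conv_def)
  next
    case (Suc i)
    have "conv ?q (?b m) k = (\<Sum>x\<in>{0, 1}. ?q x * ?b m (k - x))"
      unfolding conv_def using Suc q0 by (intro sum.mono_neutral_right) (auto simp: not_less_eq_eq)
    also have "\<dots> = (1 - a) * ?b m (Suc i) + a * ?b m i"
      using q Suc by simp
    also have "\<dots> = ?b (Suc m) (Suc i)"
    proof (cases "i < m")
      case True
      then have "m - i = Suc (m - Suc i)" by simp
      then show ?thesis by (simp add: algebra_simps)
    qed (simp add: binomial_eq_0)
    finally show ?thesis using Suc by simp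
  qed
  finally show ?case .
qed

text \<open>On the event X = m the random sum is a sum of m Bernoulli variables, independent of X;
  summing over m gives the mixture of binomial laws.\<close>

lemma law_thinning:
  fixes X :: "'a \<Rightarrow> nat"
  assumes "thinning_seq M a X B"
  shows "prob {\<omega> \<in> space M. thinning B X \<omega> = k} = thinned a (\<lambda>m. prob {\<omega> \<in> space M. X \<omega> = m}) k"
proof -
  define Y where "Y = B(0 := X)"
  have ind: "indep_vars (\<lambda>_. count_space UNIV) Y UNIV"
    using assms by (simp add: thinning_seq_def Y_def)
  have ind1: "indep_vars (\<lambda>_. count_space UNIV) B {1..}"
    using indep_vars_subset[OF ind, of "{1..}"]
    by (subst indep_vars_cong[of _ _ B Y]) (auto simp: Y_def)
  have YB: "(\<Sum>j=1..m. Y j \<omega>) = (\<Sum>j=1..m. B j \<omega>)" for m \<omega>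
    by (intro sum.cong) (auto simp: Y_def)
  have Y0: "Y 0 = X" by (simp add: Y_def)
  let ?E = "\<lambda>m. {\<omega> \<in> space M. X \<omega> = m \<and> (\<Sum>j=1..m. B j \<omega>) = k}"
  have [measurable]: "X \<in> measurable M (count_space UNIV)"
    using indep_vars_nat_measurable[OF ind, of 0] by (simp add: Y0)
  have [measurable]: "(\<lambda>\<omega>. \<Sum>j=1..m. B j \<omega>) \<in> measurable M (count_space UNIV)" for m
    by (rule measurable_sum_nat) (auto intro: indep_vars_nat_measurable[OF ind1])
  have "?E m \<in> events" for m by measurable
  then have "(\<lambda>m. prob (?E m)) sums prob (\<Union>m. ?E m)"
    by (intro finite_measure_UNION) (auto simp: disjoint_family_on_def)
  moreover have "(\<Union>m. ?E m) = {\<omega> \<in> space M. thinning B X \<omega> = k}"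
    by (auto simp: thinning_def)
  moreover have "prob (?E m) = prob {\<omega> \<in> space M. X \<omega> = m} * (real (m choose k) * a ^ k * (1 - a) ^ (m - k))" for m
    using indep_sum_nat[of "{1..m}" 0 Y m k, OF _ _ indep_vars_subset[OF ind]]
      law_bernoulli_sum[OF ind1, of a m k] assms
    by (simp add: YB[unfolded One_nat_def] Y0 thinning_seq_def)
  ultimately show ?thesis by (simp add: thinned_def sums_iff)
qed

lemma law_sums_one:
  fixes X :: "'a \<Rightarrow> nat"
  assumes [measurable]: "X \<in> measurable M (count_space UNIV)"
  shows "(\<lambda>m. prob {\<omega> \<in> space M. X \<omega> = m}) sums 1"
proof -
  have "(\<lambda>m. prob {\<omega> \<in> space M. X \<omega> = m}) sums prob (\<Union>m. {\<omega> \<in> space M. X \<omega> = m})"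
    by (rule finite_measure_UNION) (auto simp: disjoint_family_on_def)
  moreover have "(\<Union>m. {\<omega> \<in> space M. X \<omega> = m}) = space M" by auto
  ultimately show ?thesis by (simp add: prob_space)
qed

lemma expectation_nat_sums:
  fixes X :: "'a \<Rightarrow> nat"
  assumes [measurable]: "X \<in> measurable M (count_space UNIV)"
    and int: "integrable M (\<lambda>\<omega>. real (X \<omega>))"
  shows "(\<lambda>m. real m * prob {\<omega> \<in> space M. X \<omega> = m}) sums expectation (\<lambda>\<omega>. real (X \<omega>))"
proof -
  have E0: "expectation (\<lambda>\<omega>. real (X \<omega>)) \<ge> 0" by simp
  have "ennreal (expectation (\<lambda>\<omega>. real (X \<omega>))) = (\<integral>\<^sup>+\<omega>. ennreal (real (X \<omega>)) \<partial>M)"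
    using int by (intro nn_integral_eq_integral[symmetric]) auto
  also have "\<dots> = (\<integral>\<^sup>+\<omega>. (\<Sum>m. ennreal (real m) * indicator {\<omega> \<in> space M. X \<omega> = m} \<omega>) \<partial>M)"
  proof (rule nn_integral_cong)
    fix \<omega> assume "\<omega> \<in> space M"
    then show "ennreal (real (X \<omega>)) = (\<Sum>m. ennreal (real m) * indicator {\<omega> \<in> space M. X \<omega> = m} \<omega>)"
      by (subst suminf_finite[of "{X \<omega>}"]) auto
  qed
  also have "\<dots> = (\<Sum>m. \<integral>\<^sup>+\<omega>. ennreal (real m) * indicator {\<omega> \<in> space M. X \<omega> = m} \<omega> \<partial>M)"
    by (rule nn_integral_suminf) measurable
  also have "\<dots> = (\<Sum>m. ennreal (real m * prob {\<omega> \<in> space M. X \<omega> = m}))"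
    by (intro suminf_cong) (simp add: nn_integral_cmult_indicator emeasure_eq_measure ennreal_mult)
  finally have "(\<lambda>m. ennreal (real m * prob {\<omega> \<in> space M. X \<omega> = m})) sums
      ennreal (expectation (\<lambda>\<omega>. real (X \<omega>)))"
    using summable_sums[OF summableI] by metis
  then show ?thesis
    using sums_ennreal[of "\<lambda>m. real m * prob {\<omega> \<in> space M. X \<omega> = m}"] E0 by simp
qed

text \<open>Adds one variable at a time by \<open>score_bounds_conv\<close>. The induction starts at
  j = 1, since the law of the empty sum is a point mass and not everywhere positive.\<close>

lemma score_bounds_indep_sum:
  fixes Y :: "nat \<Rightarrow> 'a \<Rightarrow> nat"
  assumes ind: "indep_vars (\<lambda>_. count_space UNIV) Y {1..n}"
    and Y: "\<And>i. i \<in> {1..n} \<Longrightarrow> score_bounds (\<lambda>k. prob {\<omega> \<in> space M. Y i \<omega> = k}) m V B"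
    and j: "1 \<le> j" "j \<le> n"
  shows "score_bounds (\<lambda>k. prob {\<omega> \<in> space M. (\<Sum>i=1..j. Y i \<omega>) = k}) (real j * m) (real j * V) (real j * B)"
  using j
proof (induction j rule: nat_induct_at_least)
  case base
  then show ?case using Y[of 1] by simp
next
  case (Suc j)
  have e: "{1..Suc j} = insert (Suc j) {1..j}" by auto
  have "(\<lambda>k. prob {\<omega> \<in> space M. (\<Sum>i=1..Suc j. Y i \<omega>) = k})
    = conv (\<lambda>x. prob {\<omega> \<in> space M. Y (Suc j) \<omega> = x}) (\<lambda>x. prob {\<omega> \<in> space M. (\<Sum>i=1..j. Y i \<omega>) = x})"
    unfolding e using Suc.prems
    by (intro ext law_indep_sum_insert indep_vars_subset[OF ind]) auto
  moreover have "score_bounds \<dots> (m + real j * m) (V + real j * V) (B + real j * B)"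
    using Suc.prems by (intro score_bounds_conv Y Suc.IH) auto
  ultimately show ?case by (simp add: algebra_simps)
qed

end

section \<open>The entropy bound\<close>

text \<open>Absolute summability makes both parts finite, so the extended real difference is one of
  two convergent series.\<close>

lemma enn2ereal_suminf_pos_minus_neg:
  fixes h :: "nat \<Rightarrow> real"
  assumes "summable (\<lambda>k. \<bar>h k\<bar>)"
  shows "enn2ereal (\<Sum>k. ennreal (h k)) - enn2ereal (\<Sum>k. ennreal (- h k)) = ereal (suminf h)"
proof -
  have s: "summable (\<lambda>k. max 0 (h k))" "summable (\<lambda>k. max 0 (- h k))"
    by (rule summable_comparison_test'[OF assms, of 0]; simp)+
  have "(\<Sum>k. ennreal (h k)) = ennreal (\<Sum>k. max 0 (h k))"
    using suminf_ennreal2[OF _ s(1)] by simp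
  moreover have "(\<Sum>k. ennreal (- h k)) = ennreal (\<Sum>k. max 0 (- h k))"
    using suminf_ennreal2[OF _ s(2)] by simp
  moreover have "(\<Sum>k. max 0 (h k)) - (\<Sum>k. max 0 (- h k)) = suminf h"
    unfolding suminf_diff[OF s] by (intro suminf_cong) auto
  moreover have "(\<Sum>k. max 0 (h k)) \<ge> 0" "(\<Sum>k. max 0 (- h k)) \<ge> 0"
    using s by (auto intro!: suminf_nonneg)
  ultimately show ?thesis by (simp add: enn2ereal_ennreal)
qed

theorem corollary3p18:
  fixes M :: "'a measure"
    and X :: "'a \<Rightarrow> nat"
    and Xs :: "nat \<Rightarrow> 'a \<Rightarrow> nat"
    and B :: "nat \<Rightarrow> nat \<Rightarrow> nat \<Rightarrow> 'a \<Rightarrow> nat"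
    and T :: real
    and f :: "nat \<Rightarrow> real"
  assumes "prob_space M"
    and "X \<in> measurable M (count_space UNIV)"
    and "integrable M (\<lambda>\<omega>. real (X \<omega>))"
    and "T = integral\<^sup>L M (\<lambda>\<omega>. real (X \<omega>))"
    and "T > 0"
    and "\<And>k. f k > 0"
    and "log_concave f"
    and "has_poisson_density M T X f"
    and "iid_copies M X Xs"
    and "\<And>n i. n \<ge> 2 \<Longrightarrow> i \<in> {1..n} \<Longrightarrow> thinning_seq M (1 / real n) (Xs i) (B n i)"
    and "\<And>n. n \<ge> 2 \<Longrightarrow>
           prob_space.indep_vars M (\<lambda>_. count_space UNIV)
             (\<lambda>i. thinning (B n i) (Xs i)) {1..n}"
  shows "(\<forall>n\<ge>2.
            relative_entropy M T (\<lambda>\<omega>. \<Sum>i=1..n. thinning (B n i) (Xs i) \<omega>)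
              \<le> ereal (1 / (real n * (real n - 1)) * T\<^sup>2
                        + 1 / (real n * (real n - 1)\<^sup>2) * (T ^ 3 / 4)))
       \<and> (\<forall>c>1. \<forall>\<^sub>F n in sequentially.
            relative_entropy M T (\<lambda>\<omega>. \<Sum>i=1..n. thinning (B n i) (Xs i) \<omega>)
              \<le> ereal (c * (T\<^sup>2 / (real n)\<^sup>2)))"
proof -
  interpret prob_space M by fact
  note T = \<open>T > 0\<close> and f = \<open>\<And>k. f k > 0\<close>
  let ?S = "\<lambda>n \<omega>. \<Sum>i=1..n. thinning (B n i) (Xs i) \<omega>"
  define p where "p = (\<lambda>m. prob {\<omega> \<in> space M. X \<omega> = m})"
  have pf: "p k = f k * (T ^ k / fact k * exp (- T))" for k
    using assms(8) T by (simp add: has_poisson_density_def p_def)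
  have pp: "p k > 0" for k using f T by (simp add: pf)
  have p1: "p sums 1" using law_sums_one[OF assms(2)] by (simp add: p_def)
  have pT: "(\<lambda>m. real m * p m) sums T"
    using expectation_nat_sums[OF assms(2,3)] assms(4) by (simp add: p_def)
  \<comment> \<open>The factorials cancel those of the Poisson weights, leaving T^k times the ratio
    of the values of \<open>f\<close>.\<close>
  have ulc: "decseq (\<lambda>j. (fact (j + k) * p (j + k)) / (fact j * p j))" for k
  proof -
    have "(fact (j + k) * p (j + k)) / (fact j * p j) = T ^ k * (f (j + k) / f j)" for j
      using T f[of j] by (simp add: pf power_add)
    then show ?thesis
      using log_concave_ratio_decseq[OF assms(7) f, of k] T
      by (simp add: decseq_def mult_left_mono del: times_divide_eq_right)
  qed
  have law_Xs: "prob {\<omega> \<in> space M. Xs i \<omega> = m} = p m" if "i \<ge> 1" for i m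
  proof -
    have "Xs i \<in> measurable M (count_space UNIV)"
      using assms(9) that by (auto simp: iid_copies_def indep_vars_def)
    moreover have "measure (distr M (count_space UNIV) (Xs i)) {m} = measure (distr M (count_space UNIV) X) {m}"
      using assms(9) that by (simp add: iid_copies_def)
    ultimately show ?thesis
      using assms(2) by (simp add: measure_distr p_def vimage_def Int_def conj_commute)
  qed
  \<comment> \<open>Both claims follow from this bound: it is the first summand of the first claim,
    and n / (n - 1) times T^2 / n^2.\<close>
  have main: "relative_entropy M T (?S n) \<le> ereal (T\<^sup>2 / (real n * (real n - 1)))" if n: "n \<ge> 2" for n
  proof -
    define a where "a = 1 / real n"
    have a: "0 < a" "a < 1" using n by (auto simp: a_def)
    have "score_bounds (\<lambda>k. prob {\<omega> \<in> space M. thinning (B n i) (Xs i) \<omega> = k})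
        (a * T) ((a * T)\<^sup>2 * (a * T / (1 - a))) (a * T * (1 + a * T / (1 - a)))" if i: "i \<in> {1..n}" for i
      using thinned_score_bounds[OF pp p1 pT ulc a] law_thinning[OF assms(10)[OF n i]] law_Xs[of i] i
      by (simp add: a_def)
    from score_bounds_indep_sum[OF assms(11)[OF n] this, of n]
    have "score_bounds (\<lambda>k. prob {\<omega> \<in> space M. ?S n \<omega> = k})
        (real n * (a * T)) (real n * ((a * T)\<^sup>2 * (a * T / (1 - a)))) (real n * (a * T * (1 + a * T / (1 - a))))"
      using n by simp
    moreover have "real n * (a * T) = T" using n by (simp add: a_def)
    ultimately have sb: "score_bounds (\<lambda>k. prob {\<omega> \<in> space M. ?S n \<omega> = k}) T
        (real n * ((a * T)\<^sup>2 * (a * T / (1 - a)))) (real n * (a * T * (1 + a * T / (1 - a))))"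
      by simp
    have "relative_entropy M T (?S n) = ereal (\<Sum>k. poisson_density M T (?S n) k
        * ln (poisson_density M T (?S n) k) * pmf (poisson_pmf T) k)"
      unfolding relative_entropy_def Let_def
      by (rule enn2ereal_suminf_pos_minus_neg)
         (use poisson_entropy_le_score_variance(1)[OF T sb] in \<open>simp add: poisson_density_def\<close>)
    also have "\<dots> \<le> ereal (real n * ((a * T)\<^sup>2 * (a * T / (1 - a))) / T)"
      using poisson_entropy_le_score_variance(2)[OF T sb] by (simp add: poisson_density_def)
    also have "real n * ((a * T)\<^sup>2 * (a * T / (1 - a))) / T = T\<^sup>2 / (real n * (real n - 1))"
      using n T by (simp add: a_def divide_simps) (simp add: power2_eq_square algebra_simps)
    finally show ?thesis .
  qed
  show ?thesis
  proof (intro conjI allI impI)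
    fix n :: nat assume n: "n \<ge> 2"
    have "1 / (real n * (real n - 1)\<^sup>2) * (T ^ 3 / 4) \<ge> 0" using n T by simp
    then have "ereal (T\<^sup>2 / (real n * (real n - 1)))
      \<le> ereal (1 / (real n * (real n - 1)) * T\<^sup>2 + 1 / (real n * (real n - 1)\<^sup>2) * (T ^ 3 / 4))"
      by simp
    with main[OF n] show "relative_entropy M T (?S n)
      \<le> ereal (1 / (real n * (real n - 1)) * T\<^sup>2 + 1 / (real n * (real n - 1)\<^sup>2) * (T ^ 3 / 4))"
      by (rule order_trans)
  next
    fix c :: real assume c: "c > 1"
    have "(\<lambda>n. real n / (real n - 1)) \<longlonglongrightarrow> 1" by real_asymp
    then have "\<forall>\<^sub>F n in sequentially. real n / (real n - 1) < c"
      using c by (rule order_tendstoD)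
    then show "\<forall>\<^sub>F n in sequentially. relative_entropy M T (?S n) \<le> ereal (c * (T\<^sup>2 / (real n)\<^sup>2))"
      using eventually_ge_at_top[of 2]
    proof eventually_elim
      case (elim n)
      have "T\<^sup>2 / (real n * (real n - 1)) = real n / (real n - 1) * (T\<^sup>2 / (real n)\<^sup>2)"
        using elim by (simp add: power2_eq_square)
      also have "\<dots> \<le> c * (T\<^sup>2 / (real n)\<^sup>2)"
        using elim by (intro mult_right_mono) auto
      finally show ?case using main[OF elim(2)] by (meson ereal_less_eq(3) order_trans)
    qed
  qed
qed

end
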